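(* Let $f\colon\mathbb F_2^n\to\{+1,-1\}$ be non-linear and at most $1/10$-far from linear. Then $D^{\rightarrow}_{1/200}(f^+)>1$.
   Context: $\chi_S(x)=(-1)^{S\cdot x}$ for $S\in\mathbb F_2^n$. $f$ is non-linear if for every $S\in\mathbb F_2^n$ there is $x$ with $f(x)\ne\chi_S(x)$. $f$ is $\epsilon$-far from linear if $\max_{S\in\mathbb F_2^n}\Pr_{x\sim U(\mathbb F_2^n)}[\chi_S(x)=f(x)]=1-\epsilon$; "at most $1/10$-far" means this $\epsilon\le1/10$. $f^+(x,y)=f(x+y)$. For a distribution $\mu$ on $\mathbb F_2^n\times\mathbb F_2^n$ and $F\colon\mathbb F_2^n\times\mathbb F_2^n\to\{\pm1\}$, $D^{\rightarrow,\mu}_\delta(F)$ is the smallest $t$ such that there are $M\colon\mathbb F_2^n\to\{0,1\}^t$ (Alice's message) and $h\colon\{0,1\}^t\times\mathbb F_2^n\to\{\pm1\}$ with $\Pr_{(x,y)\sim\mu}[h(M(x),y)=F(x,y)]\ge1-\delta$; $D^{\rightarrow}_\delta(F)=\sup_\mu D^{\rightarrow,\mu}_\delta(F)$ (which equals the randomized public-coin one-way communication complexity with error $\delta$). *)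

theory Defs
  imports "HOL-Probability.Probability" "HOL-Library.Z2" "HOL-Library.Extended_Nat"
begin

instance bit :: finite
proof
  have "(UNIV :: bit set) = {0, 1}"
    by (auto intro: bit.exhaust)
  then show "finite (UNIV :: bit set)"
    by (metis finite.emptyI finite.insertI)
qed

text \<open>
  The space of dimension \<open>n = CARD('n)\<close> over the two-element field is \<open>bit ^ 'n\<close>.
  Sign-valued functions are integer-valued with values in \<open>{1, -1}\<close>.
\<close>

definition dot :: "bit ^ 'n \<Rightarrow> bit ^ 'n \<Rightarrow> bit" where
  "dot S x = (\<Sum>i\<in>UNIV. S $ i * x $ i)"

definition chi :: "bit ^ 'n \<Rightarrow> bit ^ 'n \<Rightarrow> int" where
  "chi S x = (-1) ^ (of_bit (dot S x) :: nat)"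

definition non_linear :: "(bit ^ 'n \<Rightarrow> int) \<Rightarrow> bool" where
  "non_linear f \<longleftrightarrow> (\<forall>S. \<exists>x. f x \<noteq> chi S x)"

definition far_from_linear :: "real \<Rightarrow> (bit ^ 'n \<Rightarrow> int) \<Rightarrow> bool" where
  "far_from_linear \<epsilon> f \<longleftrightarrow>
     (MAX S. measure_pmf.prob (pmf_of_set UNIV) {x. chi S x = f x}) = 1 - \<epsilon>"

definition xor_lift :: "(bit ^ 'n \<Rightarrow> int) \<Rightarrow> (bit ^ 'n) \<times> (bit ^ 'n) \<Rightarrow> int" where
  "xor_lift f = (\<lambda>(x, y). f (x + y))"

definition oneway_protocol ::
  "real \<Rightarrow> ((bit ^ 'n) \<times> (bit ^ 'n)) pmf \<Rightarrow> ((bit ^ 'n) \<times> (bit ^ 'n) \<Rightarrow> int) \<Rightarrow> nat \<Rightarrow>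
   (bit ^ 'n \<Rightarrow> bool list) \<Rightarrow> (bool list \<times> (bit ^ 'n) \<Rightarrow> int) \<Rightarrow> bool" where
  "oneway_protocol \<delta> \<mu> F t M h \<longleftrightarrow>
     M \<in> UNIV \<rightarrow> {m. length m = t} \<and>
     h \<in> {m. length m = t} \<times> UNIV \<rightarrow> {1, -1} \<and>
     measure_pmf.prob \<mu> {(x, y). h (M x, y) = F (x, y)} \<ge> 1 - \<delta>"

text \<open>
  For sign-valued \<open>F\<close> and \<open>\<delta> \<ge> 0\<close> the minimum below is attained, since sending all of \<open>x\<close> works
  with \<open>t = CARD('n)\<close> (lemma \<open>oneway_protocol_exists\<close>).
\<close>

definition oneway_complexity_dist ::
  "real \<Rightarrow> ((bit ^ 'n) \<times> (bit ^ 'n)) pmf \<Rightarrow> ((bit ^ 'n) \<times> (bit ^ 'n) \<Rightarrow> int) \<Rightarrow> nat" where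
  "oneway_complexity_dist \<delta> \<mu> F = (LEAST t. \<exists>M h. oneway_protocol \<delta> \<mu> F t M h)"

definition oneway_complexity ::
  "real \<Rightarrow> ((bit ^ 'n) \<times> (bit ^ 'n) \<Rightarrow> int) \<Rightarrow> enat" where
  "oneway_complexity \<delta> F = (SUP \<mu>. enat (oneway_complexity_dist \<delta> \<mu> F))"

lemma oneway_protocol_exists:
  fixes F :: "(bit ^ 'n) \<times> (bit ^ 'n) \<Rightarrow> int"
  assumes F: "range F \<subseteq> {1, -1}" and "\<delta> \<ge> 0"
  shows "\<exists>M h. oneway_protocol \<delta> \<mu> F CARD('n) M h"
proof -
  obtain l :: "'n list" where l: "set l = UNIV" "distinct l"
    using finite_distinct_list[of "UNIV :: 'n set"] by auto
  define M where "M = (\<lambda>x :: bit ^ 'n. map (\<lambda>i. odd (x $ i)) l)"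
  define h where "h = (\<lambda>(m, y). F (inv M m, y))"
  have len: "length l = CARD('n)"
    using l distinct_card by fastforce
  have inj: "inj M"
  proof (rule injI)
    fix x y assume "M x = M y"
    then have "odd (x $ i) = odd (y $ i)" for i
      using l by (auto simp: M_def)
    then show "x = y"
      by (metis Z2.bit_eq_iff vec_eq_iff)
  qed
  have "{(x, y). h (M x, y) = F (x, y)} = UNIV"
    by (auto simp: h_def inv_f_f[OF inj])
  moreover have "h \<in> {m. length m = CARD('n)} \<times> UNIV \<rightarrow> {1, -1}"
    using F by (auto simp: h_def)
  ultimately have "oneway_protocol \<delta> \<mu> F CARD('n) M h"
    using \<open>\<delta> \<ge> 0\<close> by (simp add: oneway_protocol_def M_def len)
  then show ?thesis by blast
qed

end

theory Submission
  imports Defs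
begin

text \<open>
  Fix a character \<open>\<chi>\<^sub>S\<close> that agrees with \<open>f\<close> outside a nonempty set \<open>A\<close> of density at most \<open>1/10\<close>.
  The hard distribution picks, with probability \<open>1/2\<close> each, a uniform pair \<open>(x, y)\<close> or a uniform
  pair with \<open>x + y \<in> A\<close>. Up to the factor \<open>\<chi>\<^sub>S(y)\<close>, known to Bob, the first half asks Bob for
  \<open>\<chi>\<^sub>S(x)\<close> on most pairs and the second half asks for \<open>- \<chi>\<^sub>S(x)\<close>. In both halves \<open>x\<close> and \<open>y\<close> are
  separately uniform. Success on the first half forces, for an average message \<open>m\<close>, that
  \<open>\<chi>\<^sub>S\<close> is nearly constant on the inputs mapped to \<open>m\<close> and that Bob outputs this constant for most \<open>y\<close>
  unless \<open>m\<close> is rare. Both properties depend only on the marginals, so they carry over to the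
  second half, where Bob then errs with constant probability.
\<close>

section \<open>Counting and averaging over message fibres\<close>

lemma real_card_Compl:
  fixes X :: "'a::finite set"
  shows "real (card (- X)) = real CARD('a) - card X"
  by (simp add: Compl_eq_Diff_UNIV card_Diff_subset of_nat_diff card_mono)

lemma minority_value:
  fixes u :: "'a \<Rightarrow> bool"
  assumes "finite X"
  obtains v where "2 * card {x \<in> X. u x \<noteq> v} \<le> card X"
proof -
  have "card {x \<in> X. u x \<noteq> True} + card {x \<in> X. u x \<noteq> False} = card X"
    using assms by (subst card_Un_disjoint[symmetric]) (auto intro!: arg_cong[where f = card])
  then show thesis
    using that[of True] that[of False] by linarith
qed

text \<open>Cauchy-Schwarz against the constant 1, since the square of a minimum is at most the
  product. It converts control of \<open>p m * q m\<close>, the size of a rectangle, into control of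
  the smaller side.\<close>

lemma sum_min_le_sqrt:
  fixes p q :: "'m \<Rightarrow> real"
  assumes "\<And>m. m \<in> T \<Longrightarrow> 0 \<le> p m" "\<And>m. m \<in> T \<Longrightarrow> 0 \<le> q m"
  shows "(\<Sum>m\<in>T. min (p m) (q m)) \<le> sqrt (card T * (\<Sum>m\<in>T. p m * q m))"
proof (rule real_le_rsqrt)
  have "(\<Sum>m\<in>T. 1 * min (p m) (q m))\<^sup>2 \<le> (\<Sum>m\<in>T. 1\<^sup>2) * (\<Sum>m\<in>T. (min (p m) (q m))\<^sup>2)"
    by (rule Cauchy_Schwarz_ineq_sum)
  also have "\<dots> \<le> card T * (\<Sum>m\<in>T. p m * q m)"
    using assms by (auto simp: power2_eq_square intro!: mult_left_mono sum_mono mult_mono)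
  finally show "(\<Sum>m\<in>T. min (p m) (q m))\<^sup>2 \<le> card T * (\<Sum>m\<in>T. p m * q m)"
    by simp
qed

text \<open>A pair is determined by its sum and either coordinate. Hence for uniform pairs with sum
  in a nonempty \<open>A\<close>, each coordinate alone is uniform.\<close>

lemma card_sum_mem:
  fixes X A :: "'a::{finite,ab_group_add} set"
  shows "card {(x, y). x \<in> X \<and> x + y \<in> A} = card X * card A"
    and "card {(x, y). y \<in> X \<and> x + y \<in> A} = card X * card A"
proof -
  have "bij_betw (\<lambda>(x, a). (x, a - x)) (X \<times> A) {(x, y). x \<in> X \<and> x + y \<in> A}"
    by (rule bij_betw_byWitness[where f' = "\<lambda>(x, y). (x, x + y)"]) auto
  then show "card {(x, y). x \<in> X \<and> x + y \<in> A} = card X * card A"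
    by (auto dest!: bij_betw_same_card simp: card_cartesian_product)
  have "bij_betw (\<lambda>(y, a). (a - y, y)) (X \<times> A) {(x, y). y \<in> X \<and> x + y \<in> A}"
    by (rule bij_betw_byWitness[where f' = "\<lambda>(x, y). (y, x + y)"]) auto
  then show "card {(x, y). y \<in> X \<and> x + y \<in> A} = card X * card A"
    by (auto dest!: bij_betw_same_card simp: card_cartesian_product)
qed

text \<open>A disagreement needs either \<open>x\<close> in the minority of its fibre or
  \<open>y\<close> among the points where Bob leaves the majority value. The first event contributes
  the term \<open>\<eta>\<close>, the second the square root.\<close>

lemma message_error_transfer:
  fixes M :: "'a::{finite,ab_group_add} \<Rightarrow> 'm" and b :: "'m \<Rightarrow> 'a \<Rightarrow> bool" and u :: "'a \<Rightarrow> bool"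
    and A :: "'a set" and \<eta> :: real
  assumes T: "finite T" "range M \<subseteq> T"
    and err: "card {(x, y). b (M x) y \<noteq> u x} \<le> \<eta> * (real CARD('a))\<^sup>2"
  shows "card {(x, y). x + y \<in> A \<and> b (M x) y \<noteq> u x}
    \<le> (\<eta> + sqrt (2 * card T * \<eta>)) * (real CARD('a) * card A)"
proof -
  define N where "N = real CARD('a)"
  have N: "N > 0" by (simp add: N_def)
  have "\<exists>v. 2 * card {x \<in> {x. M x = m}. u x \<noteq> v} \<le> card {x. M x = m}" for m
    using minority_value[of "{x. M x = m}" u] by fastforce
  then obtain v where v: "\<And>m. 2 * card {x \<in> {x. M x = m}. u x \<noteq> v m} \<le> card {x. M x = m}"
    by metis
  define P where "P m = {x. M x = m}" for m
  define R where "R m = {x. M x = m \<and> u x \<noteq> v m}" for m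
  define B where "B m = {y. b m y \<noteq> v m}" for m
  have RP: "2 * real (card (R m)) \<le> card (P m)" for m
    using v[of m] by (simp add: P_def R_def flip: of_nat_mult)
  have sub: "R m \<subseteq> P m" for m by (auto simp: P_def R_def)
  have BN: "real (card (B m)) \<le> N" for m
    by (simp add: N_def card_mono)

  \<comment> \<open>The disagreements under message \<open>m\<close>: majority inputs fail exactly
    on \<open>B m\<close>, minority inputs exactly off it.\<close>
  define E where "E m = (P m - R m) \<times> B m \<union> R m \<times> (- B m)" for m
  have cardE: "real (card (E m)) = (card (P m) - card (R m)) * real (card (B m))
      + card (R m) * (N - card (B m))" for m
  proof -
    have "card (E m) = card (P m - R m) * card (B m) + card (R m) * card (- B m)"
      unfolding E_def by (subst card_Un_disjoint) (auto simp: card_cartesian_product)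
    moreover have "real (card (- B m)) = N - card (B m)"
      by (simp add: real_card_Compl N_def)
    ultimately show ?thesis
      using sub[of m] by (simp add: card_Diff_subset of_nat_diff card_mono)
  qed
  have "{(x, y). b (M x) y \<noteq> u x} = (\<Union>m\<in>T. E m)"
    using T by (auto simp: E_def P_def R_def B_def)
  moreover have "card (\<Union>m\<in>T. E m) = (\<Sum>m\<in>T. card (E m))"
    using T by (intro card_UN_disjoint) (auto simp: E_def P_def R_def)
  ultimately have E: "(\<Sum>m\<in>T. real (card (E m))) \<le> \<eta> * N\<^sup>2"
    using err by (simp add: N_def)

  \<comment> \<open>The majority is at least as large as \<open>R m\<close>, so each
    \<open>y\<close>, in \<open>B m\<close> or not, yields at least \<open>card (R m)\<close>
    disagreements.\<close>
  have "card (R m) * N \<le> card (E m)" for m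
  proof -
    have "real (card (R m)) * card (B m) \<le> (card (P m) - card (R m)) * real (card (B m))"
      using RP[of m] by (intro mult_right_mono) auto
    then show ?thesis by (simp add: cardE algebra_simps)
  qed
  then have "(\<Sum>m\<in>T. real (card (R m)) * N) \<le> \<eta> * N\<^sup>2"
    using E by (meson order_trans sum_mono)
  then have R: "(\<Sum>m\<in>T. real (card (R m))) \<le> \<eta> * N"
    using N by (simp add: power2_eq_square flip: sum_distrib_right)

  \<comment> \<open>Each \<open>y\<close> in \<open>B m\<close> disagrees with the whole majority,
    at least half of the fibre.\<close>
  have "real (card (P m)) * card (B m) \<le> 2 * real (card (E m))" for m
  proof -
    have "real (card (P m)) * card (B m) \<le> (2 * (card (P m) - card (R m))) * real (card (B m))"
      using RP[of m] by (intro mult_right_mono) auto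
    moreover have "0 \<le> real (card (R m)) * (N - card (B m))"
      using BN[of m] by simp
    ultimately show ?thesis by (simp add: cardE)
  qed
  then have "(\<Sum>m\<in>T. real (card (P m)) * card (B m)) \<le> (\<Sum>m\<in>T. 2 * real (card (E m)))"
    by (intro sum_mono)
  also have "\<dots> \<le> 2 * (\<eta> * N\<^sup>2)"
    using E by (simp flip: sum_distrib_left)
  finally have PB: "(\<Sum>m\<in>T. real (card (P m)) * card (B m)) \<le> 2 * (\<eta> * N\<^sup>2)" .
  have "(\<Sum>m\<in>T. min (real (card (P m))) (card (B m)))
      \<le> sqrt (card T * (\<Sum>m\<in>T. real (card (P m)) * card (B m)))"
    by (rule sum_min_le_sqrt) auto
  also have "\<dots> \<le> sqrt (card T * (2 * (\<eta> * N\<^sup>2)))"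
    using PB by (intro real_sqrt_le_mono mult_left_mono) auto
  also have "\<dots> = sqrt (2 * card T * \<eta>) * N"
    using N by (simp add: real_sqrt_mult mult_ac)
  finally have PBmin: "(\<Sum>m\<in>T. min (real (card (P m))) (card (B m))) \<le> sqrt (2 * card T * \<eta>) * N" .

  define F where "F m = {(x, y). x \<in> R m \<and> x + y \<in> A}" for m
  \<comment> \<open>Given \<open>x + y \<in> A\<close> the coordinates are not independent, so no
    product bound is available here; each factor of the intersection is counted through one
    marginal, and the smaller count wins.\<close>
  define G where "G m = {(x, y). x \<in> P m \<and> x + y \<in> A} \<inter> {(x, y). y \<in> B m \<and> x + y \<in> A}" for m
  have FG: "real (card (F m \<union> G m))
      \<le> (card (R m) + min (real (card (P m))) (card (B m))) * card A" for m
  proof -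
    have "card (G m) \<le> card (P m) * card A"
      unfolding G_def card_sum_mem(1)[symmetric] by (intro card_mono) auto
    moreover have "card (G m) \<le> card (B m) * card A"
      unfolding G_def card_sum_mem(2)[symmetric] by (intro card_mono) auto
    ultimately have "real (card (G m)) \<le> min (real (card (P m))) (card (B m)) * card A"
      by (simp add: min_def flip: of_nat_mult)
    moreover have "real (card (F m)) = card (R m) * card A"
      by (simp add: F_def card_sum_mem)
    moreover have "real (card (F m \<union> G m)) \<le> card (F m) + card (G m)"
      using card_Un_le[of "F m" "G m"] by linarith
    ultimately show ?thesis by (simp add: algebra_simps)
  qed
  have "{(x, y). x + y \<in> A \<and> b (M x) y \<noteq> u x} \<subseteq> (\<Union>m\<in>T. F m \<union> G m)"
    using T by (fastforce simp: F_def G_def P_def R_def B_def)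
  then have "card {(x, y). x + y \<in> A \<and> b (M x) y \<noteq> u x} \<le> card (\<Union>m\<in>T. F m \<union> G m)"
    by (intro card_mono) auto
  also have "\<dots> \<le> (\<Sum>m\<in>T. card (F m \<union> G m))"
    using T(1) by (rule card_UN_le)
  finally have "real (card {(x, y). x + y \<in> A \<and> b (M x) y \<noteq> u x})
      \<le> (\<Sum>m\<in>T. real (card (F m \<union> G m)))"
    by (simp flip: of_nat_sum)
  also have "\<dots> \<le> (\<Sum>m\<in>T. (card (R m) + min (real (card (P m))) (card (B m))) * card A)"
    by (intro sum_mono FG)
  also have "\<dots> = ((\<Sum>m\<in>T. real (card (R m))) + (\<Sum>m\<in>T. min (real (card (P m))) (card (B m)))) * card A"
    by (simp add: sum.distrib flip: sum_distrib_right)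
  also have "\<dots> \<le> (\<eta> * N + sqrt (2 * card T * \<eta>) * N) * card A"
    using R PBmin by (intro mult_right_mono add_mono) auto
  finally show ?thesis by (simp add: N_def algebra_simps)
qed

section \<open>Characters, the mixed distribution and lower bounds for protocols\<close>

lemma chi_cases: "chi S x = 1 \<or> chi S x = -1"
  by (cases "dot S x") (simp_all add: chi_def)

lemma chi_add: "chi S (x + y) = chi S x * chi S y"
proof -
  have "dot S (x + y) = dot S x + dot S y"
    unfolding dot_def by (simp only: vector_add_component distrib_left sum.distrib)
  then show ?thesis
    unfolding chi_def by (cases "dot S x"; cases "dot S y") simp_all
qed

lemma prob_bind_coin:
  "measure_pmf.prob (bind_pmf (bernoulli_pmf (1/2)) (\<lambda>c. if c then p else q)) E
    = (measure_pmf.prob p E + measure_pmf.prob q E) / 2"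
  by (simp add: measure_pmf_bind measure_pmf.measure_bind[where N = "count_space UNIV"]
      measure_pmf_in_subprob_algebra)

text \<open>One hard distribution bounds the supremum from below. Existence of some protocol
  guarantees that the \<open>LEAST\<close> value is attained.\<close>

lemma less_oneway_complexityI:
  fixes F :: "(bit ^ 'n) \<times> (bit ^ 'n) \<Rightarrow> int"
  assumes "range F \<subseteq> {1, -1}" "\<delta> \<ge> 0"
    and no: "\<And>t M h. t \<le> k \<Longrightarrow> \<not> oneway_protocol \<delta> \<mu> F t M h"
  shows "enat k < oneway_complexity \<delta> F"
proof -
  have "\<exists>M h. oneway_protocol \<delta> \<mu> F (oneway_complexity_dist \<delta> \<mu> F) M h"
    unfolding oneway_complexity_dist_def
    using oneway_protocol_exists[OF assms(1,2)] by (rule LeastI)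
  then have "enat k < enat (oneway_complexity_dist \<delta> \<mu> F)"
    using no by (meson enat_ord_simps(2) not_le_imp_less)
  then show ?thesis
    by (auto simp: oneway_complexity_def less_SUP_iff)
qed

theorem theorem7p1:
  fixes f :: "bit ^ 'n \<Rightarrow> int" and \<epsilon> :: real
  assumes "range f \<subseteq> {1, -1}"
    and "non_linear f"
    and "far_from_linear \<epsilon> f" and "\<epsilon> \<le> 1/10"
  shows "oneway_complexity (1/200) (xor_lift f) > 1"
proof -
  define N where "N = real CARD(bit ^ 'n)"
  have N: "N > 0" by (simp add: N_def)
  let ?prob = "\<lambda>S. measure_pmf.prob (pmf_of_set UNIV) {x. chi S x = f x}"
  have "Max (range ?prob) \<in> range ?prob"
    by (intro Max_in) auto
  then obtain S where "?prob S = 1 - \<epsilon>"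
    using assms(3) unfolding far_from_linear_def by (metis (lifting) rangeE)
  define A where "A = {x. f x \<noteq> chi S x}"
  have "{x. chi S x = f x} = - A" by (auto simp: A_def)
  then have "real (card (- A)) / N = 1 - \<epsilon>"
    using \<open>?prob S = 1 - \<epsilon>\<close> by (simp add: measure_pmf_of_set N_def)
  moreover have "real (card (- A)) = N - card A"
    by (simp add: real_card_Compl N_def)
  ultimately have cardA: "real (card A) \<le> N / 10"
    using N \<open>\<epsilon> \<le> 1/10\<close> by (simp add: field_simps)
  \<comment> \<open>This makes \<open>D\<close> nonempty, so that \<open>pmf_of_set D\<close> is
    meaningful, and permits cancelling \<open>card A\<close> at the end.\<close>
  have "A \<noteq> {}" using assms(2) by (auto simp: A_def non_linear_def)
  then have A0: "real (card A) > 0" by (simp add: card_gt_0_iff)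

  define D where "D = {(x, y). x + y \<in> A}"
  have cardD: "real (card D) = N * card A"
    using card_sum_mem(1)[of UNIV A] by (simp add: D_def N_def)
  have "card D > 0" using N A0 cardD by (metis mult_pos_pos of_nat_0_less_iff)
  then have D: "D \<noteq> {}" "finite D" by (auto simp: card_gt_0_iff)
  define \<mu> where
    "\<mu> = bind_pmf (bernoulli_pmf (1/2)) (\<lambda>c. if c then pmf_of_set UNIV else pmf_of_set D)"

  have "\<not> oneway_protocol (1/200) \<mu> (xor_lift f) t M h" if "t \<le> 1" for t M h
  proof
    assume "oneway_protocol (1/200) \<mu> (xor_lift f) t M h"
    then have M: "range M \<subseteq> {m. length m = t}"
      and h: "\<And>m y. length m = t \<Longrightarrow> h (m, y) \<in> {1, -1}"
      and pr: "measure_pmf.prob \<mu> {(x, y). h (M x, y) = f (x + y)} \<ge> 199/200"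
      by (auto simp: oneway_protocol_def xor_lift_def)
    define Good where "Good = {(x, y). h (M x, y) = f (x + y)}"
    have "measure_pmf.prob (pmf_of_set UNIV) Good + measure_pmf.prob (pmf_of_set D) Good \<ge> 199/100"
      using pr by (simp add: \<mu>_def prob_bind_coin Good_def)
    \<comment> \<open>Each half has weight 1/2, so error 1/200 on the mixture allows error at most
      1/100 on either half.\<close>
    then have "measure_pmf.prob (pmf_of_set UNIV) Good \<ge> 99/100"
      "measure_pmf.prob (pmf_of_set D) Good \<ge> 99/100"
      using measure_pmf.prob_le_1[of "pmf_of_set UNIV" Good]
        measure_pmf.prob_le_1[of "pmf_of_set D" Good] by linarith+
    then have good1: "real (card Good) \<ge> 99/100 * N\<^sup>2"
      and good2: "real (card (D \<inter> Good)) \<ge> 99/100 * (N * card A)"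
      using D N A0
      by (simp_all add: measure_pmf_of_set cardD N_def power2_eq_square field_simps)

    \<comment> \<open>Dividing Bob's output by \<open>chi S y\<close> turns it into a guess
      \<open>b\<close> of \<open>u x\<close>, the sign of \<open>chi S x\<close>.\<close>
    define b where "b m y \<longleftrightarrow> h (m, y) = chi S y" for m y
    define u where "u x \<longleftrightarrow> chi S x = 1" for x
    have b: "b (M x) y \<noteq> u x \<longleftrightarrow> h (M x, y) \<noteq> chi S (x + y)" for x y
      using h[of "M x" y] subsetD[OF M rangeI, of x] chi_cases[of S x] chi_cases[of S y]
      by (auto simp: b_def u_def chi_add)
    \<comment> \<open>Off \<open>D\<close> a disagreement is a protocol error. Errors have density
      at most 1/100 and \<open>D\<close> at most 1/10, whence 11/100 below.\<close>
    have "{(x, y). b (M x) y \<noteq> u x} \<subseteq> - Good \<union> D"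
      using b by (fastforce simp: Good_def D_def A_def)
    then have "card {(x, y). b (M x) y \<noteq> u x} \<le> card (- Good \<union> D)"
      by (intro card_mono) auto
    also have "\<dots> \<le> card (- Good) + card D" by (rule card_Un_le)
    finally have "real (card {(x, y). b (M x) y \<noteq> u x}) \<le> card (- Good) + real (card D)"
      by linarith
    moreover have "real (card (- Good)) = N\<^sup>2 - card Good"
      by (simp add: real_card_Compl N_def power2_eq_square)
    moreover have "real (card D) \<le> N\<^sup>2 / 10"
      using cardA N by (simp add: cardD power2_eq_square)
    ultimately have err: "card {(x, y). b (M x) y \<noteq> u x} \<le> 11/100 * (real CARD(bit ^ 'n))\<^sup>2"
      using good1 unfolding N_def[symmetric] by linarith

    let ?T = "{m :: bool list. length m = t}"
    have T: "finite ?T" "card ?T = 2 ^ t"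
      using finite_lists_length_eq[of "UNIV :: bool set" t]
        card_lists_length_eq[of "UNIV :: bool set" t] by simp_all
    \<comment> \<open>On \<open>D\<close> the roles flip: a correct output differs from the
      character, so it is a disagreement.\<close>
    have "D \<inter> Good \<subseteq> {(x, y). x + y \<in> A \<and> b (M x) y \<noteq> u x}"
      using b by (fastforce simp: Good_def D_def A_def)
    then have "real (card (D \<inter> Good)) \<le> card {(x, y). x + y \<in> A \<and> b (M x) y \<noteq> u x}"
      by (simp add: card_mono)
    also have "\<dots> \<le> (11/100 + sqrt (2 * card ?T * (11/100))) * (real CARD(bit ^ 'n) * card A)"
      by (rule message_error_transfer[OF T(1) M err])
    finally have "99/100 * (N * card A) \<le> (11/100 + sqrt (2 * card ?T * (11/100))) * (N * card A)"
      using good2 unfolding N_def by (rule order_trans[rotated])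
    then have "99/100 \<le> 11/100 + sqrt (2 * card ?T * (11/100))"
      using N A0 by (subst (asm) mult_le_cancel_right_pos) auto
    \<comment> \<open>At most two messages exist, and 44/100 is below the square of 7/10; the
      transferred bound is then at most 81/100, short of 99/100.\<close>
    moreover have "2 * card ?T * (11/100) \<le> (44/100 :: real)"
      unfolding T(2) using that by (cases t) auto
    then have "sqrt (2 * card ?T * (11/100)) \<le> 7/10"
      by (intro real_le_lsqrt) (auto simp: power2_eq_square)
    ultimately show False by simp
  qed
  moreover have "range (xor_lift f) \<subseteq> {1, -1}"
    using assms(1) by (auto simp: xor_lift_def)
  ultimately have "enat 1 < oneway_complexity (1/200) (xor_lift f)"
    by (intro less_oneway_complexityI) auto
  then show ?thesis by (simp add: one_enat_def)
qed

end
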